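(* Let $\mathcal{B}$ be a unital Banach algebra, let $k\geqslant 1$ and $n_1,\ldots,n_k\geqslant 1$ be integers, let $\{P_{ij}\}_{1\leqslant i\leqslant n_j,\,1\leqslant j\leqslant k}$ be a finite decomposition of $\mathcal{B}$, and let $T_{ij}\in P_{ij}\mathcal{B}P_{ij}$ be such that $\mathcal{Q}(T_{ij},P_{ij}\mathcal{B}P_{ij})\cong\mathbb{C}$ for all $1\leqslant i\leqslant n_j$, $1\leqslant j\leqslant k$, and such that for all $1\leqslant j_1,j_2\leqslant k$, $1\leqslant i_1\leqslant n_{j_1}$, $1\leqslant i_2\leqslant n_{j_2}$, we have $(T_{i_1j_1},P_{i_1j_1}\mathcal{B}P_{i_1j_1})\sim(T_{i_2j_2},P_{i_2j_2}\mathcal{B}P_{i_2j_2})$ if and only if $j_1=j_2$. Let $T=\sum_{j=1}^{k}\sum_{i=1}^{n_j}T_{ij}$. Then $\mathcal{Q}(T,\mathcal{B})\cong\bigoplus_{j=1}^k\mathbb{M}_{n_j}$ as algebras.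
   Context: Banach algebras are over $\mathbb{C}$; $\mathbb{M}_m$ is the algebra of $m\times m$ complex matrices. For a unital Banach algebra $\mathcal{C}$ and $S\in\mathcal{C}$ put $(S,\mathcal{C})'=\{X\in\mathcal{C}\colon SX=XS\}$ and $\mathcal{Q}(S,\mathcal{C})=(S,\mathcal{C})'/\mathrm{Rad}((S,\mathcal{C})')$, where $\mathrm{Rad}$ is the Jacobson radical. For a nonzero idempotent $P\in\mathcal{B}$, $P\mathcal{B}P$ is a unital Banach algebra with unit $P$. A finite decomposition of $\mathcal{B}$ is a finite family of nonzero idempotents in $\mathcal{B}$ whose sum is the identity and whose pairwise products (for distinct members) are $0$. For nonzero idempotents $P_1,P_2\in\mathcal{B}$ and $T_j\in P_j\mathcal{B}P_j$ ($j=1,2$), $(T_1,P_1\mathcal{B}P_1)\sim(T_2,P_2\mathcal{B}P_2)$ means that there exist $X_{12}\in P_1\mathcal{B}P_2$ and $X_{21}\in P_2\mathcal{B}P_1$ with $X_{12}X_{21}=P_1$, $X_{21}X_{12}=P_2$, and $T_2=X_{21}T_1X_{12}$. *)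

theory Defs
  imports
    "HOL-Analysis.Analysis"
    "HOL-Algebra.QuotRing"
    "HOL-Algebra.Module"
    "Jordan_Normal_Form.Matrix"
begin

text \<open>The norm is complete and submultiplicative; \<open>norm 1 = 1\<close> is deliberately not required, because
  the unit \<open>P\<close> of a corner \<open>P\<B>P\<close> may have norm greater than 1.\<close>

class complex_banach_algebra_1 = real_algebra_1 + real_normed_algebra + banach +
  fixes scaleC :: "complex \<Rightarrow> 'a \<Rightarrow> 'a"  (infixr \<open>*\<^sub>C\<close> 75)
  assumes scaleC_add_right: "c *\<^sub>C (x + y) = c *\<^sub>C x + c *\<^sub>C y"
    and scaleC_add_left: "(c + d) *\<^sub>C x = c *\<^sub>C x + d *\<^sub>C x"
    and scaleC_scaleC: "c *\<^sub>C d *\<^sub>C x = (c * d) *\<^sub>C x"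
    and scaleC_of_real: "complex_of_real r *\<^sub>C x = r *\<^sub>R x"
    and mult_scaleC_left: "(c *\<^sub>C x) * y = c *\<^sub>C (x * y)"
    and mult_scaleC_right: "x * (c *\<^sub>C y) = c *\<^sub>C (x * y)"
    and norm_scaleC: "norm (c *\<^sub>C x) = cmod c * norm x"

instantiation complex :: complex_banach_algebra_1
begin

definition scaleC_complex_def: "scaleC = ((*) :: complex \<Rightarrow> complex \<Rightarrow> complex)"

instance
  by standard (simp_all add: scaleC_complex_def algebra_simps scaleR_conv_of_real norm_mult)

end

text \<open>A complex algebra with carrier in \<open>'a\<close> is given as a record of type \<open>(complex, 'a) module\<close>.
  (The library locale \<open>algebra\<close> on these records is restricted to commutative algebras and is not used.)\<close>

definition univ_alg :: "(complex, 'b::complex_banach_algebra_1) module" where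
  "univ_alg = \<lparr>carrier = UNIV, mult = (*), one = 1, zero = 0, add = (+), smult = scaleC\<rparr>"

definition alg_iso :: "(complex, 'a) module \<Rightarrow> (complex, 'b) module \<Rightarrow> ('a \<Rightarrow> 'b) set" where
  "alg_iso A B = {h \<in> ring_iso A B.
     \<forall>c. \<forall>x \<in> carrier A. h (c \<odot>\<^bsub>A\<^esub> x) = c \<odot>\<^bsub>B\<^esub> h x}"

definition is_alg_iso :: "(complex, 'a) module \<Rightarrow> (complex, 'b) module \<Rightarrow> bool"
    (infix \<open>\<cong>\<^sub>a\<^sub>l\<^sub>g\<close> 50) where
  "A \<cong>\<^sub>a\<^sub>l\<^sub>g B \<longleftrightarrow> alg_iso A B \<noteq> {}"

text \<open>The library's quotient ring, with scalar multiplication on cosets in the style of \<open>rcoset_mult\<close>.\<close>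

definition quot_alg :: "(complex, 'a) module \<Rightarrow> 'a set \<Rightarrow> (complex, 'a set) module" where
  "quot_alg A I = ring.extend (A Quot I)
     (module.fields (\<lambda>c X. \<Union>x\<in>X. I +>\<^bsub>A\<^esub> (c \<odot>\<^bsub>A\<^esub> x)))"

definition direct_sum_alg :: "'i set \<Rightarrow> ('i \<Rightarrow> (complex, 'a) module) \<Rightarrow> (complex, 'i \<Rightarrow> 'a) module" where
  "direct_sum_alg I A = \<lparr>carrier = (\<Pi>\<^sub>E i\<in>I. carrier (A i)),
     mult = (\<lambda>f g. \<lambda>i\<in>I. f i \<otimes>\<^bsub>A i\<^esub> g i), one = (\<lambda>i\<in>I. \<one>\<^bsub>A i\<^esub>),
     zero = (\<lambda>i\<in>I. \<zero>\<^bsub>A i\<^esub>), add = (\<lambda>f g. \<lambda>i\<in>I. f i \<oplus>\<^bsub>A i\<^esub> g i),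
     smult = (\<lambda>c f. \<lambda>i\<in>I. c \<odot>\<^bsub>A i\<^esub> f i)\<rparr>"

abbreviation mat_alg :: "nat \<Rightarrow> (complex, complex mat) module" where
  "mat_alg m \<equiv> module_mat TYPE(complex) m m"

definition left_ideal :: "'a set \<Rightarrow> (complex, 'a) module \<Rightarrow> bool" where
  "left_ideal I A \<longleftrightarrow> additive_subgroup I A \<and> (\<forall>a \<in> carrier A. \<forall>x \<in> I. a \<otimes>\<^bsub>A\<^esub> x \<in> I)"

definition maximal_left_ideal :: "'a set \<Rightarrow> (complex, 'a) module \<Rightarrow> bool" where
  "maximal_left_ideal M A \<longleftrightarrow> left_ideal M A \<and> M \<noteq> carrier A \<and>
     (\<forall>J. left_ideal J A \<and> M \<subseteq> J \<longrightarrow> J = M \<or> J = carrier A)"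

definition jacobson_radical :: "(complex, 'a) module \<Rightarrow> 'a set" where
  "jacobson_radical A = carrier A \<inter> \<Inter> {M. maximal_left_ideal M A}"

definition commutant :: "'a \<Rightarrow> (complex, 'a) module \<Rightarrow> (complex, 'a) module" where
  "commutant S A = A\<lparr>carrier := {X \<in> carrier A. S \<otimes>\<^bsub>A\<^esub> X = X \<otimes>\<^bsub>A\<^esub> S}\<rparr>"

definition comm_mod_rad :: "'a \<Rightarrow> (complex, 'a) module \<Rightarrow> (complex, 'a set) module" where
  "comm_mod_rad S A = quot_alg (commutant S A) (jacobson_radical (commutant S A))"

definition peirce :: "'b::complex_banach_algebra_1 \<Rightarrow> 'b \<Rightarrow> 'b set" where
  "peirce P Q = range (\<lambda>X. P * X * Q)"

definition corner_alg :: "'b::complex_banach_algebra_1 \<Rightarrow> (complex, 'b) module" where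
  "corner_alg P = univ_alg\<lparr>carrier := peirce P P, one := P\<rparr>"

definition nonzero_idempotent :: "'b::complex_banach_algebra_1 \<Rightarrow> bool" where
  "nonzero_idempotent P \<longleftrightarrow> P \<noteq> 0 \<and> P * P = P"

definition finite_decomposition :: "'i set \<Rightarrow> ('i \<Rightarrow> 'b::complex_banach_algebra_1) \<Rightarrow> bool" where
  "finite_decomposition I P \<longleftrightarrow> finite I \<and> (\<forall>i\<in>I. nonzero_idempotent (P i)) \<and>
     (\<Sum>i\<in>I. P i) = 1 \<and> (\<forall>i\<in>I. \<forall>j\<in>I. i \<noteq> j \<longrightarrow> P i * P j = 0)"

text \<open>\<open>corner_similar T\<^sub>1 P\<^sub>1 T\<^sub>2 P\<^sub>2\<close> is the relation \<open>(T\<^sub>1, P\<^sub>1\<B>P\<^sub>1) \<sim> (T\<^sub>2, P\<^sub>2\<B>P\<^sub>2)\<close>; it is meant for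
  nonzero idempotents \<open>P\<^sub>1\<close>, \<open>P\<^sub>2\<close> and \<open>T\<^sub>1\<close>, \<open>T\<^sub>2\<close> in the respective corners.\<close>

definition corner_similar ::
    "'b::complex_banach_algebra_1 \<Rightarrow> 'b \<Rightarrow> 'b \<Rightarrow> 'b \<Rightarrow> bool" where
  "corner_similar T\<^sub>1 P\<^sub>1 T\<^sub>2 P\<^sub>2 \<longleftrightarrow> (\<exists>X\<^sub>1\<^sub>2 \<in> peirce P\<^sub>1 P\<^sub>2. \<exists>X\<^sub>2\<^sub>1 \<in> peirce P\<^sub>2 P\<^sub>1.
     X\<^sub>1\<^sub>2 * X\<^sub>2\<^sub>1 = P\<^sub>1 \<and> X\<^sub>2\<^sub>1 * X\<^sub>1\<^sub>2 = P\<^sub>2 \<and> T\<^sub>2 = X\<^sub>2\<^sub>1 * T\<^sub>1 * X\<^sub>1\<^sub>2)"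

end

theory Submission
  imports Defs
begin

text \<open>Let \<open>S\<close> be the commutant of \<open>T\<close>. Each \<open>P\<^sub>i\<^sub>j\<close> commutes with \<open>T\<close>, and \<open>P\<^sub>i\<^sub>j S P\<^sub>i\<^sub>j\<close> is the
commutant of \<open>T\<^sub>i\<^sub>j\<close> in \<open>P\<^sub>i\<^sub>j\<B>P\<^sub>i\<^sub>j\<close>; by hypothesis it is \<open>\<complex>\<close> modulo its radical, hence a local
ring. The relation \<open>\<sim>\<close> says precisely that two of the idempotents are equivalent inside \<open>S\<close>
(\<open>corner_similar_in_commutant\<close>). So the \<open>P\<^sub>i\<^sub>j\<close> split \<open>1\<close> into local idempotents of \<open>S\<close>, and
\<open>S\<close> modulo its radical must be a product of matrix algebras, one for each equivalence class, just
as for a semiperfect ring.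

The isomorphism is explicit. In the class \<open>j\<close> fix the base idempotent \<open>q\<^sub>j = P\<^sub>1\<^sub>j\<close> and equivalences
\<open>u\<^sub>j\<^sub>a \<in> q\<^sub>j S\<close>, \<open>v\<^sub>j\<^sub>a \<in> S q\<^sub>j\<close> with \<open>u\<^sub>j\<^sub>a v\<^sub>j\<^sub>b = \<delta>\<^sub>a\<^sub>b q\<^sub>j\<close> and \<open>\<Sum> v\<^sub>j\<^sub>a u\<^sub>j\<^sub>a = 1\<close>, and let \<open>\<phi>\<^sub>j\<close> be the
character of the local algebra \<open>q\<^sub>j S q\<^sub>j\<close>. Send \<open>x\<close> to the matrices with entries
\<open>\<phi>\<^sub>j (u\<^sub>j\<^sub>a x v\<^sub>j\<^sub>b)\<close>. Inserting \<open>1 = \<Sum> v\<^sub>i\<^sub>c u\<^sub>i\<^sub>c\<close> between \<open>x\<close> and \<open>y\<close> gives multiplicativity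
(\<open>entry_mult\<close>), as soon as the terms with \<open>i \<noteq> j\<close> disappear. They do: if \<open>x \<in> q\<^sub>j S q\<^sub>i\<close>,
\<open>y \<in> q\<^sub>i S q\<^sub>j\<close> and \<open>\<phi>\<^sub>j (x y) \<noteq> 0\<close>, then \<open>x y\<close> is left invertible in the local algebra
\<open>q\<^sub>j S q\<^sub>j\<close>, which makes \<open>q\<^sub>j\<close> and \<open>q\<^sub>i\<close> equivalent
(\<open>equivalent_of_character_nonzero\<close>). Surjectivity is clear from the images of \<open>v\<^sub>j\<^sub>a u\<^sub>j\<^sub>b\<close>.

Finally the kernel is the radical (\<open>rad_eq_entry_kernel\<close>). The elements whose \<open>b\<close>-th column in the
block \<open>j\<close> vanishes form a maximal left ideal, so the radical is contained in the kernel.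
Conversely, if a maximal left ideal \<open>M\<close> misses \<open>x v u\<close> for some \<open>x\<close> in the kernel, where
\<open>v u = P\<^sub>i\<^sub>j\<close>, then \<open>v u = b x v u + m\<close> with \<open>m \<in> M\<close>; since \<open>q - u b x v\<close> has character value
\<open>1\<close>, it is left invertible, so \<open>v u \<in> M\<close>, which is absurd.\<close>

section \<open>Unital subalgebras and their left ideals\<close>

abbreviation subalg :: "'b::complex_banach_algebra_1 set \<Rightarrow> 'b \<Rightarrow> (complex, 'b) module" where
  "subalg S p \<equiv> univ_alg\<lparr>carrier := S, one := p\<rparr>"

lemma subalg_simps [simp]:
  "carrier (subalg S p) = S" "mult (subalg S p) = (*)" "add (subalg S p) = (+)"
  "one (subalg S p) = p" "zero (subalg S p) = 0" "module.smult (subalg S p) = scaleC"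
  by (simp_all add: univ_alg_def)

lemma scaleC_zero_left [simp]: "0 *\<^sub>C (x::'b::complex_banach_algebra_1) = 0"
  using scaleC_of_real[of 0 x] by simp

lemma scaleC_minus_one [simp]: "(- 1) *\<^sub>C (x::'b::complex_banach_algebra_1) = - x"
  using scaleC_of_real[of "- 1" x] by simp

text \<open>The unit \<open>p\<close> is a parameter because the algebras in question are corners of one another: the
commutant of \<open>T\<close> has unit \<open>1\<close>, and its corner at an idempotent \<open>q\<close> has unit \<open>q\<close>.\<close>

locale unital_subalgebra =
  fixes S :: "'b::complex_banach_algebra_1 set" and p :: 'b
  assumes add_closed: "x \<in> S \<Longrightarrow> y \<in> S \<Longrightarrow> x + y \<in> S"
    and mult_closed: "x \<in> S \<Longrightarrow> y \<in> S \<Longrightarrow> x * y \<in> S"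
    and scaleC_closed: "x \<in> S \<Longrightarrow> c *\<^sub>C x \<in> S"
    and unit_closed: "p \<in> S"
    and unit_left: "x \<in> S \<Longrightarrow> p * x = x"
    and unit_right: "x \<in> S \<Longrightarrow> x * p = x"
begin

lemma zero_closed: "0 \<in> S"
  using scaleC_closed[OF unit_closed, of 0] by simp

lemma uminus_closed: "x \<in> S \<Longrightarrow> - x \<in> S"
  using scaleC_closed[of x "- 1"] by simp

lemma diff_closed: "x \<in> S \<Longrightarrow> y \<in> S \<Longrightarrow> x - y \<in> S"
  using add_closed[of x "- y"] uminus_closed by simp

lemma sum_closed: "(\<And>i. i \<in> I \<Longrightarrow> f i \<in> S) \<Longrightarrow> (\<Sum>i\<in>I. f i) \<in> S"
  by (induction I rule: infinite_finite_induct) (auto intro: zero_closed add_closed)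

lemmas closed = add_closed mult_closed scaleC_closed unit_closed zero_closed uminus_closed
  diff_closed

lemma ring_subalg: "ring (subalg S p)"
proof (rule ringI)
  show "abelian_group (subalg S p)"
  proof (rule abelian_groupI)
    fix x assume "x \<in> carrier (subalg S p)"
    then show "\<exists>y\<in>carrier (subalg S p). y \<oplus>\<^bsub>subalg S p\<^esub> x = \<zero>\<^bsub>subalg S p\<^esub>"
      by (auto intro!: bexI[of _ "- x"] uminus_closed)
  qed (auto simp: closed)
  show "Group.monoid (subalg S p)"
    by (rule monoidI) (auto simp: closed unit_left unit_right mult.assoc)
qed (auto simp: algebra_simps)

text \<open>Closure under negation comes for free, as \<open>- x = (- p) * x\<close>.\<close>

lemma left_ideal_iff:
  "left_ideal L (subalg S p) \<longleftrightarrow>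
    L \<subseteq> S \<and> 0 \<in> L \<and> (\<forall>x\<in>L. \<forall>y\<in>L. x + y \<in> L) \<and> (\<forall>a\<in>S. \<forall>x\<in>L. a * x \<in> L)" (is "_ \<longleftrightarrow> ?R")
proof
  assume "left_ideal L (subalg S p)"
  then show ?R
    by (auto simp: left_ideal_def additive_subgroup_def subgroup_def)
next
  assume R: ?R
  interpret ring "subalg S p" by (rule ring_subalg)
  have "subgroup L (add_monoid (subalg S p))"
  proof (rule add.subgroupI)
    fix x assume x: "x \<in> L"
    then have "x \<in> S" using R by blast
    then have "\<ominus>\<^bsub>subalg S p\<^esub> x = - x"
      by (intro minus_equality) (simp_all add: uminus_closed)
    moreover have "- x \<in> L"
      using R x uminus_closed[OF unit_closed] unit_left[OF \<open>x \<in> S\<close>]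
      by (metis mult_minus_left)
    ultimately show "\<ominus>\<^bsub>subalg S p\<^esub> x \<in> L" by simp
  qed (use R in auto)
  then show "left_ideal L (subalg S p)"
    using R by (auto simp: left_ideal_def additive_subgroup_def)
qed

lemma left_ideal_eq_carrier:
  assumes "left_ideal L (subalg S p)" "p \<in> L"
  shows "L = S"
  using assms unit_right by (force simp: left_ideal_iff)

lemma left_ideal_sum:
  assumes "left_ideal L (subalg S p)" "\<And>i. i \<in> I \<Longrightarrow> f i \<in> L"
  shows "(\<Sum>i\<in>I. f i) \<in> L"
  using assms(2)
  by (induction I rule: infinite_finite_induct) (use assms(1) in \<open>auto simp: left_ideal_iff\<close>)

lemma left_ideal_set_sum:
  assumes "left_ideal L (subalg S p)" "left_ideal M (subalg S p)"
  shows "left_ideal {x + y |x y. x \<in> L \<and> y \<in> M} (subalg S p)" (is "left_ideal ?N _")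
  unfolding left_ideal_iff
proof (intro conjI ballI)
  show "?N \<subseteq> S" using assms by (auto simp: left_ideal_iff intro!: add_closed)
  show "0 \<in> ?N" using assms by (force simp: left_ideal_iff)
next
  fix x y assume "x \<in> ?N" "y \<in> ?N"
  then obtain a b c d where "x = a + b" "y = c + d" "a \<in> L" "b \<in> M" "c \<in> L" "d \<in> M" by auto
  then have "x + y = (a + c) + (b + d)" "a + c \<in> L" "b + d \<in> M"
    using assms by (auto simp: left_ideal_iff)
  then show "x + y \<in> ?N" by blast
next
  fix a x assume "a \<in> S" "x \<in> ?N"
  then obtain b c where "a * x = a * b + a * c" "b \<in> L" "c \<in> M" by (auto simp: distrib_left)
  moreover from this have "a * b \<in> L" "a * c \<in> M"
    using assms \<open>a \<in> S\<close> by (auto simp: left_ideal_iff)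
  ultimately show "a * x \<in> ?N" by blast
qed

lemma left_ideal_principal:
  assumes "x \<in> S"
  shows "left_ideal ((\<lambda>a. a * x) ` S) (subalg S p)" and "x \<in> (\<lambda>a. a * x) ` S"
proof -
  show "left_ideal ((\<lambda>a. a * x) ` S) (subalg S p)"
    unfolding left_ideal_iff
  proof (intro conjI ballI)
    show "(\<lambda>a. a * x) ` S \<subseteq> S" using assms by (auto intro: closed)
    show "0 \<in> (\<lambda>a. a * x) ` S" using zero_closed by (intro image_eqI[of _ _ 0]) auto
  next
    fix y z assume "y \<in> (\<lambda>a. a * x) ` S" "z \<in> (\<lambda>a. a * x) ` S"
    then show "y + z \<in> (\<lambda>a. a * x) ` S"
      by (auto simp flip: distrib_right intro: closed)
  next
    fix b y assume "b \<in> S" "y \<in> (\<lambda>a. a * x) ` S"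
    then show "b * y \<in> (\<lambda>a. a * x) ` S"
      by (auto simp flip: mult.assoc intro: closed)
  qed
  show "x \<in> (\<lambda>a. a * x) ` S"
    using unit_left[OF assms] unit_closed by (metis image_eqI)
qed

lemma maximal_left_ideal_comaximal:
  assumes M: "maximal_left_ideal M (subalg S p)" and L: "left_ideal L (subalg S p)"
    and nsub: "\<not> L \<subseteq> M" and s: "s \<in> S"
  obtains x m where "x \<in> L" "m \<in> M" "s = x + m"
proof -
  let ?N = "{x + y |x y. x \<in> L \<and> y \<in> M}"
  have M': "left_ideal M (subalg S p)" using M by (simp add: maximal_left_ideal_def)
  have z: "0 \<in> L" "0 \<in> M" using M' L by (auto simp: left_ideal_iff)
  have "M \<subseteq> ?N"
  proof
    fix m assume "m \<in> M"
    then show "m \<in> ?N" using z(1) by (intro CollectI exI[of _ 0] exI[of _ m]) simp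
  qed
  moreover have L_N: "L \<subseteq> ?N"
  proof
    fix x assume "x \<in> L"
    then show "x \<in> ?N" using z(2) by (intro CollectI exI[of _ x] exI[of _ 0]) simp
  qed
  moreover have "left_ideal ?N (subalg S p)" by (rule left_ideal_set_sum[OF L M'])
  ultimately have "?N = M \<or> ?N = S" using M unfolding maximal_left_ideal_def by simp
  then have "?N = S" using L_N nsub by blast
  then show ?thesis using s that by blast
qed

lemma ex_maximal_left_ideal:
  assumes L: "left_ideal L (subalg S p)" and ne: "p \<notin> L"
  obtains M where "maximal_left_ideal M (subalg S p)" "L \<subseteq> M"
proof -
  define F where "F = {J. left_ideal J (subalg S p) \<and> L \<subseteq> J \<and> p \<notin> J}"
  have "\<exists>M\<in>F. \<forall>X\<in>F. M \<subseteq> X \<longrightarrow> X = M"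
  proof (rule subset_Zorn_nonempty)
    show "F \<noteq> {}" using assms by (auto simp: F_def)
  next
    fix C assume C: "C \<noteq> {}" "subset.chain F C"
    then have CF: "\<And>J. J \<in> C \<Longrightarrow> left_ideal J (subalg S p) \<and> L \<subseteq> J \<and> p \<notin> J"
      and tot: "\<And>J K. J \<in> C \<Longrightarrow> K \<in> C \<Longrightarrow> J \<subseteq> K \<or> K \<subseteq> J"
      by (auto simp: subset.chain_def F_def)
    have "left_ideal (\<Union>C) (subalg S p)"
      unfolding left_ideal_iff
    proof (intro conjI ballI)
      show "\<Union>C \<subseteq> S" using CF unfolding left_ideal_iff by (intro Union_least) blast
      show "0 \<in> \<Union>C" using CF C(1) by (auto simp: left_ideal_iff)
    next
      fix x y assume "x \<in> \<Union>C" "y \<in> \<Union>C"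
      then obtain J K where "J \<in> C" "K \<in> C" "x \<in> J" "y \<in> K" by auto
      with tot[of J K] obtain N where N: "N \<in> C" "x \<in> N" "y \<in> N" by blast
      then have "x + y \<in> N" using CF[of N] by (auto simp: left_ideal_iff)
      then show "x + y \<in> \<Union>C" using N by blast
    next
      fix a x assume "a \<in> S" "x \<in> \<Union>C"
      then obtain J where J: "J \<in> C" "x \<in> J" by auto
      then have "a * x \<in> J" using CF[of J] \<open>a \<in> S\<close> by (auto simp: left_ideal_iff)
      then show "a * x \<in> \<Union>C" using J by blast
    qed
    then show "\<Union>C \<in> F" using CF C(1) by (auto simp: F_def)
  qed
  then obtain M where M: "M \<in> F" "\<And>X. X \<in> F \<Longrightarrow> M \<subseteq> X \<Longrightarrow> X = M" by auto
  have "maximal_left_ideal M (subalg S p)"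
    unfolding maximal_left_ideal_def
  proof (intro conjI allI impI)
    show "left_ideal M (subalg S p)" using M by (simp add: F_def)
    show "M \<noteq> carrier (subalg S p)" using M(1) unit_closed by (auto simp: F_def)
  next
    fix J assume J: "left_ideal J (subalg S p) \<and> M \<subseteq> J"
    show "J = M \<or> J = carrier (subalg S p)"
    proof (cases "p \<in> J")
      case True
      then show ?thesis using J left_ideal_eq_carrier by simp
    next
      case False
      then have "J \<in> F" using J M(1) by (auto simp: F_def)
      then show ?thesis using M(2) J by auto
    qed
  qed
  then show ?thesis using that M(1) by (auto simp: F_def)
qed

subsection \<open>The Jacobson radical\<close>

abbreviation rad :: "'b set" where
  "rad \<equiv> jacobson_radical (subalg S p)"

lemma rad_iff: "x \<in> rad \<longleftrightarrow> x \<in> S \<and> (\<forall>M. maximal_left_ideal M (subalg S p) \<longrightarrow> x \<in> M)"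
  by (auto simp: jacobson_radical_def)

lemma rad_left_ideal: "left_ideal rad (subalg S p)"
  unfolding left_ideal_iff
  by (auto simp: rad_iff maximal_left_ideal_def left_ideal_iff closed)

text \<open>Otherwise \<open>S (p - r)\<close> would lie in a maximal left ideal, which also contains \<open>r\<close>, hence \<open>p\<close>.\<close>

lemma left_inverse_diff_rad:
  assumes "r \<in> rad"
  obtains c where "c \<in> S" "c * (p - r) = p"
proof -
  have r: "r \<in> S" "p - r \<in> S" using assms by (auto simp: rad_iff closed)
  note L = left_ideal_principal[OF r(2)]
  have "p \<in> (\<lambda>a. a * (p - r)) ` S"
  proof (rule ccontr)
    assume "p \<notin> (\<lambda>a. a * (p - r)) ` S"
    with L(1) obtain M where M: "maximal_left_ideal M (subalg S p)"
      and sub: "(\<lambda>a. a * (p - r)) ` S \<subseteq> M" by (rule ex_maximal_left_ideal)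
    have M': "left_ideal M (subalg S p)" "M \<noteq> S"
      using M by (auto simp: maximal_left_ideal_def)
    have "p - r \<in> M" "r \<in> M" using sub L(2) assms M by (auto simp: rad_iff)
    then have "(p - r) + r \<in> M" using M'(1) unfolding left_ideal_iff by blast
    then show False using left_ideal_eq_carrier[OF M'(1)] M'(2) by simp
  qed
  then show ?thesis using that by (metis imageE)
qed

text \<open>For a maximal left ideal \<open>M\<close>, the left ideal \<open>{y. y a \<in> M}\<close> is either everything (if \<open>a \<in> M\<close>) or
again maximal, because it is the annihilator of the vector \<open>a + M\<close> of the simple module \<open>S/M\<close>. So it
contains the radical.\<close>

lemma rad_mult_right:
  assumes x: "x \<in> rad" and a: "a \<in> S"
  shows "x * a \<in> rad"
  unfolding rad_iff
proof (intro conjI allI impI)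
  have xS: "x \<in> S" using x by (simp add: rad_iff)
  then show "x * a \<in> S" using a by (rule mult_closed)
  fix M assume M: "maximal_left_ideal M (subalg S p)"
  then have M': "left_ideal M (subalg S p)" by (simp add: maximal_left_ideal_def)
  define N where "N = {y \<in> S. y * a \<in> M}"
  have N: "left_ideal N (subalg S p)"
    using M' by (auto simp: N_def left_ideal_iff closed distrib_right mult.assoc)
  have "x \<in> N"
  proof (cases "a \<in> M")
    case True
    then show ?thesis using M' xS by (auto simp: N_def left_ideal_iff)
  next
    case False
    have "maximal_left_ideal N (subalg S p)"
      unfolding maximal_left_ideal_def
    proof (intro conjI allI impI)
      show "N \<noteq> carrier (subalg S p)"
        using False unit_closed unit_left[OF a] by (force simp: N_def)
    next
      fix J assume J: "left_ideal J (subalg S p) \<and> N \<subseteq> J"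
      show "J = N \<or> J = carrier (subalg S p)"
      proof (rule disjCI)
        assume "J \<noteq> carrier (subalg S p)"
        show "J = N"
        proof (rule ccontr)
          assume "J \<noteq> N"
          then obtain y where y: "y \<in> J" "y \<notin> N" using J by auto
          then have yS: "y \<in> S" and ya: "y * a \<notin> M" "y * a \<in> S"
            using J a by (auto simp: N_def left_ideal_iff closed)
          note L = left_ideal_principal[OF ya(2)]
          have nsub: "\<not> (\<lambda>b. b * (y * a)) ` S \<subseteq> M" using L(2) ya(1) by blast
          obtain z m where z: "z \<in> (\<lambda>b. b * (y * a)) ` S" "m \<in> M" "a = z + m"
            by (rule maximal_left_ideal_comaximal[OF M L(1) nsub a])
          then obtain b where b: "b \<in> S" and m: "m \<in> M" "a = b * (y * a) + m" by auto
          have "(p - b * y) * a = a - b * (y * a)"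
            using unit_left[OF a] by (simp add: left_diff_distrib mult.assoc)
          also have "\<dots> = m" using m(2) by (metis add_diff_cancel_left')
          finally have "(p - b * y) * a = m" .
          then have "p - b * y \<in> N" using m(1) b yS by (auto simp: N_def closed)
          moreover have "b * y \<in> J" using J b y(1) by (auto simp: left_ideal_iff)
          ultimately have "(p - b * y) + b * y \<in> J" using J unfolding left_ideal_iff by blast
          then have "p \<in> J" by simp
          then show False
            using left_ideal_eq_carrier J \<open>J \<noteq> carrier (subalg S p)\<close> by simp
        qed
      qed
    qed (rule N)
    then show ?thesis using x by (simp add: rad_iff)
  qed
  then show "x * a \<in> M" by (simp add: N_def)
qed

subsection \<open>Quotients and characters\<close>

lemma ideal_subalgI:
  assumes "left_ideal I (subalg S p)" "\<And>x a. x \<in> I \<Longrightarrow> a \<in> S \<Longrightarrow> x * a \<in> I"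
  shows "ideal I (subalg S p)"
  using assms ring_subalg
  by (intro idealI) (auto simp: left_ideal_def additive_subgroup_def)

lemma coset_scaleC:
  assumes I: "ideal I (subalg S p)" and x: "x \<in> S"
  shows "c \<odot>\<^bsub>quot_alg (subalg S p) I\<^esub> (I +>\<^bsub>subalg S p\<^esub> x) = I +>\<^bsub>subalg S p\<^esub> (c *\<^sub>C x)"
proof -
  interpret ideal I "subalg S p" by fact
  have coset: "I +>\<^bsub>subalg S p\<^esub> (c *\<^sub>C y) = I +>\<^bsub>subalg S p\<^esub> (c *\<^sub>C x)"
    if y: "y \<in> I +>\<^bsub>subalg S p\<^esub> x" for y
  proof -
    obtain i where i: "i \<in> I" "y = i + x" using y by (auto simp: a_r_coset_def')
    have iS: "i \<in> S" using i(1) a_subset by auto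
    have "c *\<^sub>C i = (c *\<^sub>C p) * i" by (simp add: mult_scaleC_left unit_left iS)
    then have "c *\<^sub>C i \<in> I" using I_l_closed[OF i(1)] scaleC_closed[OF unit_closed] by simp
    then have "c *\<^sub>C y \<in> I +>\<^bsub>subalg S p\<^esub> (c *\<^sub>C x)"
      by (auto simp: a_r_coset_def' i(2) scaleC_add_right)
    then show ?thesis
      using a_repr_independence[OF _ _ a_subgroup] x by (simp add: closed)
  qed
  have "x \<in> I +>\<^bsub>subalg S p\<^esub> x" using a_rcos_self x by simp
  then have "(\<Union>y\<in>I +>\<^bsub>subalg S p\<^esub> x. I +>\<^bsub>subalg S p\<^esub> (c *\<^sub>C y)) = I +>\<^bsub>subalg S p\<^esub> (c *\<^sub>C x)"
    using coset by blast
  then show ?thesis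
    by (simp add: quot_alg_def ring.defs module.defs)
qed

lemma quot_alg_simps:
  "carrier (quot_alg (subalg S p) I) = (\<lambda>x. I +>\<^bsub>subalg S p\<^esub> x) ` S"
  "\<one>\<^bsub>quot_alg (subalg S p) I\<^esub> = I +>\<^bsub>subalg S p\<^esub> p"
  by (auto simp: quot_alg_def ring.defs module.defs FactRing_def A_RCOSETS_def')

lemma coset_add_mult:
  assumes I: "ideal I (subalg S p)" and x: "x \<in> S" and y: "y \<in> S"
  shows "(I +>\<^bsub>subalg S p\<^esub> x) \<oplus>\<^bsub>quot_alg (subalg S p) I\<^esub> (I +>\<^bsub>subalg S p\<^esub> y)
           = I +>\<^bsub>subalg S p\<^esub> (x + y)"
    and "(I +>\<^bsub>subalg S p\<^esub> x) \<otimes>\<^bsub>quot_alg (subalg S p) I\<^esub> (I +>\<^bsub>subalg S p\<^esub> y)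
           = I +>\<^bsub>subalg S p\<^esub> (x * y)"
proof -
  interpret ideal I "subalg S p" by fact
  show "(I +>\<^bsub>subalg S p\<^esub> x) \<oplus>\<^bsub>quot_alg (subalg S p) I\<^esub> (I +>\<^bsub>subalg S p\<^esub> y)
           = I +>\<^bsub>subalg S p\<^esub> (x + y)"
    using a_rcos_sum[of x y] x y by (simp add: quot_alg_def ring.defs module.defs FactRing_def)
  show "(I +>\<^bsub>subalg S p\<^esub> x) \<otimes>\<^bsub>quot_alg (subalg S p) I\<^esub> (I +>\<^bsub>subalg S p\<^esub> y)
           = I +>\<^bsub>subalg S p\<^esub> (x * y)"
    using rcoset_mult_add[of x y] x y by (simp add: quot_alg_def ring.defs module.defs FactRing_def)
qed

lemma coset_eq_iff:
  assumes I: "ideal I (subalg S p)" and x: "x \<in> S" and y: "y \<in> S"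
  shows "I +>\<^bsub>subalg S p\<^esub> x = I +>\<^bsub>subalg S p\<^esub> y \<longleftrightarrow> x - y \<in> I"
proof -
  interpret ideal I "subalg S p" by fact
  show ?thesis
  proof
    assume "I +>\<^bsub>subalg S p\<^esub> x = I +>\<^bsub>subalg S p\<^esub> y"
    moreover have "x \<in> I +>\<^bsub>subalg S p\<^esub> x" using a_rcos_self x by simp
    ultimately show "x - y \<in> I" by (auto simp: a_r_coset_def')
  next
    assume "x - y \<in> I"
    then have "x \<in> I +>\<^bsub>subalg S p\<^esub> y" by (auto simp: a_r_coset_def' intro!: bexI[of _ "x - y"])
    then show "I +>\<^bsub>subalg S p\<^esub> x = I +>\<^bsub>subalg S p\<^esub> y"
      using a_repr_independence[OF _ _ a_subgroup] y by simp
  qed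
qed

text \<open>The first isomorphism theorem for the scalar-carrying quotient. The target is an arbitrary record,
so that its ring axioms need not be established separately.\<close>

lemma quot_alg_isoI:
  assumes I: "ideal I (subalg S p)"
    and surj: "f ` S = carrier B"
    and one: "f p = \<one>\<^bsub>B\<^esub>"
    and add: "\<And>x y. x \<in> S \<Longrightarrow> y \<in> S \<Longrightarrow> f (x + y) = f x \<oplus>\<^bsub>B\<^esub> f y"
    and mult: "\<And>x y. x \<in> S \<Longrightarrow> y \<in> S \<Longrightarrow> f (x * y) = f x \<otimes>\<^bsub>B\<^esub> f y"
    and scale: "\<And>c x. x \<in> S \<Longrightarrow> f (c *\<^sub>C x) = c \<odot>\<^bsub>B\<^esub> f x"
    and ker: "\<And>x y. x \<in> S \<Longrightarrow> y \<in> S \<Longrightarrow> f x = f y \<longleftrightarrow> x - y \<in> I"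
  shows "quot_alg (subalg S p) I \<cong>\<^sub>a\<^sub>l\<^sub>g B"
proof -
  let ?A = "subalg S p"
  let ?Q = "quot_alg ?A I"
  define h where "h X = f (SOME x. x \<in> S \<and> X = I +>\<^bsub>?A\<^esub> x)" for X
  have h: "h (I +>\<^bsub>?A\<^esub> x) = f x" if x: "x \<in> S" for x
  proof -
    let ?y = "SOME y. y \<in> S \<and> I +>\<^bsub>?A\<^esub> x = I +>\<^bsub>?A\<^esub> y"
    have y: "?y \<in> S \<and> I +>\<^bsub>?A\<^esub> x = I +>\<^bsub>?A\<^esub> ?y" by (rule someI[of _ x]) (use x in simp)
    then have "f x = f ?y" using ker coset_eq_iff[OF I] x by blast
    then show ?thesis by (simp add: h_def)
  qed
  have "h \<in> Ring.ring_hom ?Q B"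
    by (rule ring_hom_memI)
       (use surj in \<open>auto simp: quot_alg_simps h closed coset_add_mult[OF I] add mult one\<close>)
  moreover have "bij_betw h (carrier ?Q) (carrier B)"
    unfolding bij_betw_def
  proof
    show "inj_on h (carrier ?Q)"
      unfolding quot_alg_simps inj_on_def by (simp add: h ker coset_eq_iff[OF I])
    show "h ` carrier ?Q = carrier B"
      using h by (simp add: quot_alg_simps image_image flip: surj)
  qed
  moreover have "\<forall>c. \<forall>x\<in>carrier ?Q. h (c \<odot>\<^bsub>?Q\<^esub> x) = c \<odot>\<^bsub>B\<^esub> h x"
    by (auto simp: quot_alg_simps h coset_scaleC[OF I] closed scale)
  ultimately have "h \<in> alg_iso ?Q B" by (simp add: alg_iso_def ring_iso_def)
  then show ?thesis by (auto simp: is_alg_iso_def)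
qed

text \<open>An isomorphism of the quotient by the radical with \<open>\<complex>\<close> is a character whose kernel is the radical.
An element \<open>x\<close> outside the kernel is left invertible: rescale it to have character value \<open>1\<close>; then
it differs from \<open>p\<close> by an element of the radical.\<close>

lemma character_of_local:
  assumes iso: "quot_alg (subalg S p) rad \<cong>\<^sub>a\<^sub>l\<^sub>g (univ_alg :: (complex, complex) module)"
  obtains \<phi> :: "'b \<Rightarrow> complex" where
    "\<And>x y. x \<in> S \<Longrightarrow> y \<in> S \<Longrightarrow> \<phi> (x + y) = \<phi> x + \<phi> y"
    "\<And>x y. x \<in> S \<Longrightarrow> y \<in> S \<Longrightarrow> \<phi> (x * y) = \<phi> x * \<phi> y"
    "\<And>c x. x \<in> S \<Longrightarrow> \<phi> (c *\<^sub>C x) = c * \<phi> x"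
    "\<phi> p = 1"
    "\<And>x. x \<in> S \<Longrightarrow> \<phi> x \<noteq> 0 \<Longrightarrow> \<exists>c\<in>S. c * x = p"
proof -
  let ?A = "subalg S p"
  let ?Q = "quot_alg ?A rad"
  have I: "ideal rad ?A" by (rule ideal_subalgI[OF rad_left_ideal rad_mult_right])
  obtain h where h: "h \<in> Ring.ring_hom ?Q (univ_alg :: (complex, complex) module)"
    and inj: "inj_on h (carrier ?Q)"
    and hs: "\<And>c x. x \<in> carrier ?Q \<Longrightarrow> h (c \<odot>\<^bsub>?Q\<^esub> x) = c * h x"
    using iso by (auto simp: is_alg_iso_def alg_iso_def ring_iso_def bij_betw_def univ_alg_def
        scaleC_complex_def)
  define \<phi> where "\<phi> x = h (rad +>\<^bsub>?A\<^esub> x)" for x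
  have coset: "x \<in> S \<Longrightarrow> rad +>\<^bsub>?A\<^esub> x \<in> carrier ?Q" for x by (auto simp: quot_alg_simps)
  have univ: "add univ_alg = (+)" "mult univ_alg = (*)" "one univ_alg = (1::complex)"
    by (simp_all add: univ_alg_def)
  have add: "\<phi> (x + y) = \<phi> x + \<phi> y" if "x \<in> S" "y \<in> S" for x y
    using ring_hom_add[OF h coset[OF that(1)] coset[OF that(2)]]
    by (simp add: \<phi>_def univ coset_add_mult[OF I that])
  have mult: "\<phi> (x * y) = \<phi> x * \<phi> y" if "x \<in> S" "y \<in> S" for x y
    using ring_hom_mult[OF h coset[OF that(1)] coset[OF that(2)]]
    by (simp add: \<phi>_def univ coset_add_mult[OF I that])
  have scale: "\<phi> (c *\<^sub>C x) = c * \<phi> x" if "x \<in> S" for c x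
    using hs[OF coset[OF that]] by (simp add: \<phi>_def coset_scaleC[OF I that])
  have one: "\<phi> p = 1"
    using ring_hom_one[OF h] by (simp add: \<phi>_def univ quot_alg_simps)
  have inv: "\<exists>c\<in>S. c * x = p" if x: "x \<in> S" and ne: "\<phi> x \<noteq> 0" for x
  proof -
    define y where "y = (1 / \<phi> x) *\<^sub>C x"
    have y: "y \<in> S" "\<phi> y = 1" using x ne by (auto simp: y_def closed scale)
    then have "rad +>\<^bsub>?A\<^esub> p = rad +>\<^bsub>?A\<^esub> y"
      using inj_onD[OF inj _ coset coset] one unit_closed by (simp add: \<phi>_def)
    then have "p - y \<in> rad" using coset_eq_iff[OF I unit_closed y(1)] by simp
    then obtain c where c: "c \<in> S" "c * (p - (p - y)) = p" by (rule left_inverse_diff_rad)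
    then have "((1 / \<phi> x) *\<^sub>C c) * x = p" by (simp add: y_def mult_scaleC_left mult_scaleC_right)
    then show ?thesis using c(1) by (auto intro: scaleC_closed)
  qed
  show ?thesis by (rule that[OF add mult scale one inv])
qed

end

section \<open>Local corners and equivalent idempotents\<close>

text \<open>Since \<open>e (p - e) = 0\<close>, whichever of \<open>e\<close> and \<open>p - e\<close> has nonzero character value cancels the
other.\<close>

lemma (in unital_subalgebra) local_idempotent:
  fixes \<phi> :: "'b \<Rightarrow> complex"
  assumes add: "\<And>x y. x \<in> S \<Longrightarrow> y \<in> S \<Longrightarrow> \<phi> (x + y) = \<phi> x + \<phi> y"
    and one: "\<phi> p = 1"
    and inv: "\<And>x. x \<in> S \<Longrightarrow> \<phi> x \<noteq> 0 \<Longrightarrow> \<exists>c\<in>S. c * x = p"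
    and e: "e \<in> S" "e * e = e" "e \<noteq> 0"
  shows "e = p"
proof -
  have "\<phi> e \<noteq> 0"
  proof
    assume "\<phi> e = 0"
    then have "\<phi> (p - e) \<noteq> 0"
      using add[of "p - e" e] e(1) one by (simp add: closed)
    then obtain c where c: "c * (p - e) = p"
      using inv[of "p - e"] e(1) by (auto simp: closed)
    have "e = c * (p - e) * e" using c unit_left[OF e(1)] by simp
    also have "\<dots> = 0" using e(2) unit_left[OF e(1)] by (simp add: mult.assoc left_diff_distrib)
    finally show False using e(3) by simp
  qed
  then obtain c where c: "c * e = p" using inv[OF e(1)] by auto
  have "e = c * e * e" using c unit_left[OF e(1)] by simp
  also have "\<dots> = c * e" using e(2) by (simp add: mult.assoc)
  finally show ?thesis using c by simp
qed

lemma (in unital_subalgebra) unital_subalgebra_corner: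
  assumes "q \<in> S" "q * q = q"
  shows "unital_subalgebra {x \<in> S. q * x = x \<and> x * q = x} q"
proof
  fix x y assume x: "x \<in> {x \<in> S. q * x = x \<and> x * q = x}" and y: "y \<in> {x \<in> S. q * x = x \<and> x * q = x}"
  then show "x + y \<in> {x \<in> S. q * x = x \<and> x * q = x}"
    by (simp add: closed distrib_left distrib_right)
  have "q * (x * y) = x * y" using x by (simp flip: mult.assoc)
  then show "x * y \<in> {x \<in> S. q * x = x \<and> x * q = x}"
    using x y by (simp add: closed mult.assoc)
  show "c *\<^sub>C x \<in> {x \<in> S. q * x = x \<and> x * q = x}" for c
    using x by (simp add: closed mult_scaleC_left mult_scaleC_right)
qed (use assms in auto)

text \<open>If \<open>c\<close> is a left inverse of \<open>x y\<close> in the corner at \<open>P\<close>, then \<open>x' = c x\<close> is a left inverse of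
\<open>y\<close>, so \<open>y x'\<close> is a nonzero idempotent in the corner at \<open>Q\<close>. The latter corner is local, hence
\<open>y x' = Q\<close>.\<close>

lemma (in unital_subalgebra) equivalent_of_character_nonzero:
  fixes \<phi> \<psi> :: "'b \<Rightarrow> complex"
  defines "C \<equiv> \<lambda>e. {x \<in> S. e * x = x \<and> x * e = x}"
  assumes P: "P \<in> S" "P * P = P" "P \<noteq> 0" and Q: "Q \<in> S" "Q * Q = Q"
    and \<phi>_inv: "\<And>x. x \<in> C P \<Longrightarrow> \<phi> x \<noteq> 0 \<Longrightarrow> \<exists>c\<in>C P. c * x = P"
    and \<psi>_add: "\<And>x y. x \<in> C Q \<Longrightarrow> y \<in> C Q \<Longrightarrow> \<psi> (x + y) = \<psi> x + \<psi> y"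
    and \<psi>_one: "\<psi> Q = 1"
    and \<psi>_inv: "\<And>x. x \<in> C Q \<Longrightarrow> \<psi> x \<noteq> 0 \<Longrightarrow> \<exists>c\<in>C Q. c * x = Q"
    and x: "x \<in> S" "P * x = x" "x * Q = x" and y: "y \<in> S" "Q * y = y" "y * P = y"
    and ne: "\<phi> (x * y) \<noteq> 0"
  obtains x' where "x' \<in> S" "P * x' = x'" "x' * Q = x'" "x' * y = P" "y * x' = Q"
proof -
  have "P * (x * y) = x * y" using x(2) by (simp flip: mult.assoc)
  then have "x * y \<in> C P" using x y by (simp add: C_def closed mult.assoc)
  then obtain c where c: "c \<in> C P" "c * (x * y) = P" using \<phi>_inv ne by blast
  define x' where "x' = c * x"
  have x': "x' \<in> S" "P * x' = x'" "x' * Q = x'" "x' * y = P"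
    using c x by (auto simp: x'_def C_def closed mult.assoc) (simp flip: mult.assoc)
  interpret CQ: unital_subalgebra "C Q" Q
    unfolding C_def using Q by (rule unital_subalgebra_corner)
  have "y * x' = Q"
  proof (rule CQ.local_idempotent[of \<psi>, OF \<psi>_add \<psi>_one \<psi>_inv])
    have "Q * (y * x') = y * x'" using y(2) by (simp flip: mult.assoc)
    then show "y * x' \<in> C Q" using x' y by (simp add: C_def closed mult.assoc)
    have "y * x' * (y * x') = y * ((x' * y) * x')" by (simp add: mult.assoc)
    then show "y * x' * (y * x') = y * x'" using x' by simp
    have "x' * (y * x') * y = (x' * y) * (x' * y)" by (simp add: mult.assoc)
    then have "x' * (y * x') * y = P" using x'(4) P(2) by simp
    then show "y * x' \<noteq> 0" using P(3) by auto
  qed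
  then show ?thesis using that x' by blast
qed

section \<open>Matrix entries with respect to a frame of local idempotents\<close>

text \<open>The data left over once the idempotents \<open>P\<^sub>i\<^sub>j\<close> have been written as \<open>v j a * u j a\<close>: one base
idempotent \<open>q j\<close> with a character \<open>\<phi> j\<close> of its corner \<open>C j\<close> for each class \<open>j\<close>, and the elements
\<open>u j a\<close>, \<open>v j a\<close> that move between \<open>q j\<close> and the members of its class. The last assumption is
what inequivalence of distinct classes amounts to for the characters.\<close>

locale local_matrix_frame = unital_subalgebra S 1
  for S :: "'b::complex_banach_algebra_1 set" +
  fixes J :: "'j set" and n :: "'j \<Rightarrow> nat" and q :: "'j \<Rightarrow> 'b"
    and u v :: "'j \<Rightarrow> nat \<Rightarrow> 'b" and \<phi> :: "'j \<Rightarrow> 'b \<Rightarrow> complex"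
    and C :: "'j \<Rightarrow> 'b set"
  defines "C \<equiv> \<lambda>j. {x \<in> S. q j * x = x \<and> x * q j = x}"
  assumes finite_J: "finite J"
    and q_closed: "j \<in> J \<Longrightarrow> q j \<in> S"
    and q_idem: "j \<in> J \<Longrightarrow> q j * q j = q j"
    and u_closed: "j \<in> J \<Longrightarrow> a < n j \<Longrightarrow> u j a \<in> S"
    and v_closed: "j \<in> J \<Longrightarrow> a < n j \<Longrightarrow> v j a \<in> S"
    and q_u: "j \<in> J \<Longrightarrow> a < n j \<Longrightarrow> q j * u j a = u j a"
    and v_q: "j \<in> J \<Longrightarrow> a < n j \<Longrightarrow> v j a * q j = v j a"
    and u_v: "j \<in> J \<Longrightarrow> a < n j \<Longrightarrow> i \<in> J \<Longrightarrow> b < n i \<Longrightarrow>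
                u j a * v i b = (if j = i \<and> a = b then q j else 0)"
    and sum_v_u: "(\<Sum>j\<in>J. \<Sum>a<n j. v j a * u j a) = 1"
    and char_add: "j \<in> J \<Longrightarrow> x \<in> C j \<Longrightarrow> y \<in> C j \<Longrightarrow> \<phi> j (x + y) = \<phi> j x + \<phi> j y"
    and char_mult: "j \<in> J \<Longrightarrow> x \<in> C j \<Longrightarrow> y \<in> C j \<Longrightarrow> \<phi> j (x * y) = \<phi> j x * \<phi> j y"
    and char_scaleC: "j \<in> J \<Longrightarrow> x \<in> C j \<Longrightarrow> \<phi> j (c *\<^sub>C x) = c * \<phi> j x"
    and char_unit: "j \<in> J \<Longrightarrow> \<phi> j (q j) = 1"
    and char_inverse: "j \<in> J \<Longrightarrow> x \<in> C j \<Longrightarrow> \<phi> j x \<noteq> 0 \<Longrightarrow> \<exists>c\<in>C j. c * x = q j"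
    and char_orthogonal: "j \<in> J \<Longrightarrow> i \<in> J \<Longrightarrow> j \<noteq> i \<Longrightarrow> x \<in> S \<Longrightarrow> y \<in> S \<Longrightarrow>
                \<phi> j ((q j * x * q i) * (q i * y * q j)) = 0"
begin

lemma q_in_C: "j \<in> J \<Longrightarrow> q j \<in> C j"
  by (simp add: C_def q_closed q_idem)

lemma C_add: "x \<in> C j \<Longrightarrow> y \<in> C j \<Longrightarrow> x + y \<in> C j"
  by (auto simp: C_def closed distrib_left distrib_right)

lemma C_scaleC: "x \<in> C j \<Longrightarrow> c *\<^sub>C x \<in> C j"
  by (auto simp: C_def closed mult_scaleC_left mult_scaleC_right)

lemma C_zero: "0 \<in> C j"
  by (auto simp: C_def closed)

lemma C_sum: "(\<And>i. i \<in> I \<Longrightarrow> f i \<in> C j) \<Longrightarrow> (\<Sum>i\<in>I. f i) \<in> C j"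
  by (induction I rule: infinite_finite_induct) (auto intro: C_zero C_add)

lemma char_zero: "j \<in> J \<Longrightarrow> \<phi> j 0 = 0"
  using char_add[of j 0 0] C_zero by simp

lemma char_sum:
  assumes "j \<in> J" "\<And>i. i \<in> I \<Longrightarrow> f i \<in> C j"
  shows "\<phi> j (\<Sum>i\<in>I. f i) = (\<Sum>i\<in>I. \<phi> j (f i))"
  using assms(2)
  by (induction I rule: infinite_finite_induct) (auto simp: char_zero char_add assms(1) C_sum)

lemma compression_in_C:
  assumes "j \<in> J" "a < n j" "b < n j" "x \<in> S"
  shows "u j a * x * v j b \<in> C j"
proof -
  have "q j * (u j a * x * v j b) = (q j * u j a) * x * v j b" by (simp add: mult.assoc)
  then show ?thesis
    using assms by (simp add: C_def closed u_closed v_closed q_u v_q mult.assoc)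
qed

definition entry :: "'j \<Rightarrow> nat \<Rightarrow> nat \<Rightarrow> 'b \<Rightarrow> complex" where
  "entry j a b x = \<phi> j (u j a * x * v j b)"

context
  fixes j a b assumes j: "j \<in> J" and a: "a < n j" and b: "b < n j"
begin

lemma entry_add: "x \<in> S \<Longrightarrow> y \<in> S \<Longrightarrow> entry j a b (x + y) = entry j a b x + entry j a b y"
  using char_add[OF j compression_in_C[OF j a b] compression_in_C[OF j a b]]
  by (simp add: entry_def distrib_left distrib_right)

lemma entry_scaleC: "x \<in> S \<Longrightarrow> entry j a b (c *\<^sub>C x) = c * entry j a b x"
  using char_scaleC[OF j compression_in_C[OF j a b]]
  by (simp add: entry_def mult_scaleC_left mult_scaleC_right)

lemma entry_diff: "x \<in> S \<Longrightarrow> y \<in> S \<Longrightarrow> entry j a b (x - y) = entry j a b x - entry j a b y"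
  using entry_add[of "x - y" y] by (simp add: closed)

lemma entry_zero: "entry j a b 0 = 0"
  by (simp add: entry_def char_zero j)

lemma entry_sum: "(\<And>i. i \<in> I \<Longrightarrow> f i \<in> S) \<Longrightarrow> entry j a b (\<Sum>i\<in>I. f i) = (\<Sum>i\<in>I. entry j a b (f i))"
  by (induction I rule: infinite_finite_induct) (auto simp: entry_zero entry_add sum_closed)

lemma entry_unit:
  assumes "i \<in> J" "c < n i" "d < n i"
  shows "entry j a b (v i c * u i d) = (if i = j \<and> c = a \<and> d = b then 1 else 0)"
proof -
  have "u j a * (v i c * u i d) * v j b = (u j a * v i c) * (u i d * v j b)"
    by (simp add: mult.assoc)
  then show ?thesis
    using assms j a b by (auto simp: entry_def u_v char_zero char_unit q_idem)
qed

lemma entry_one: "entry j a b 1 = (if a = b then 1 else 0)"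
  using j a b by (simp add: entry_def u_v char_zero char_unit)

text \<open>The unit between \<open>x\<close> and \<open>y\<close> is expanded as \<open>\<Sum> v i c * u i c\<close>. The terms of the class \<open>j\<close> make up
the matrix product; those of the other classes are killed by \<open>\<phi> j\<close>.\<close>

lemma entry_mult:
  assumes x: "x \<in> S" and y: "y \<in> S"
  shows "entry j a b (x * y) = (\<Sum>c<n j. entry j a c x * entry j c b y)"
proof -
  define t where "t i c = (u j a * x * v i c) * (u i c * y * v j b)" for i c
  have t_C: "t i c \<in> C j" if "i \<in> J" "c < n i" for i c
    using compression_in_C[OF j a b, of "x * v i c * (u i c * y)"] that x y
    by (simp add: t_def closed u_closed v_closed mult.assoc)
  have t_char: "\<phi> j (t i c) = (if i = j then entry j a c x * entry j c b y else 0)"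
    if i: "i \<in> J" and c: "c < n i" for i c
  proof (cases "i = j")
    case True
    then show ?thesis
      using char_mult[OF j compression_in_C[OF j a _ x] compression_in_C[OF j _ b y]] c
      by (simp add: t_def entry_def)
  next
    case False
    have "u j a * x * v i c = q j * (u j a * x * v i c) * q i"
      using i c j a by (simp add: mult.assoc v_q) (simp add: q_u flip: mult.assoc)
    moreover have "u i c * y * v j b = q i * (u i c * y * v j b) * q j"
      using i c j b by (simp add: mult.assoc v_q) (simp add: q_u flip: mult.assoc)
    ultimately have "t i c = (q j * (u j a * x * v i c) * q i) * (q i * (u i c * y * v j b) * q j)"
      by (simp add: t_def)
    moreover have "u j a * x * v i c \<in> S" "u i c * y * v j b \<in> S"
      using i c j a b x y by (simp_all add: closed u_closed v_closed)
    ultimately show ?thesis using char_orthogonal j i False by metis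
  qed
  have "u j a * (x * y) * v j b = u j a * x * (\<Sum>i\<in>J. \<Sum>c<n i. v i c * u i c) * (y * v j b)"
    by (simp add: sum_v_u mult.assoc)
  also have "\<dots> = (\<Sum>i\<in>J. \<Sum>c<n i. t i c)"
    by (simp add: sum_distrib_left sum_distrib_right t_def mult.assoc)
  finally have "entry j a b (x * y) = \<phi> j (\<Sum>i\<in>J. \<Sum>c<n i. t i c)"
    by (simp add: entry_def)
  also have "\<dots> = (\<Sum>i\<in>J. \<phi> j (\<Sum>c<n i. t i c))"
    by (rule char_sum) (auto intro: j C_sum t_C)
  also have "\<dots> = (\<Sum>i\<in>J. \<Sum>c<n i. \<phi> j (t i c))"
    by (intro sum.cong refl char_sum j) (auto intro: t_C)
  also have "\<dots> = (\<Sum>i\<in>J. if i = j then \<Sum>c<n j. entry j a c x * entry j c b y else 0)"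
    by (intro sum.cong refl) (auto simp: t_char)
  also have "\<dots> = (\<Sum>c<n j. entry j a c x * entry j c b y)"
    using j finite_J by simp
  finally show ?thesis .
qed

end

definition entry_kernel :: "'b set" where
  "entry_kernel = {x \<in> S. \<forall>j\<in>J. \<forall>a<n j. \<forall>b<n j. entry j a b x = 0}"

lemma entry_kernel_left_ideal: "left_ideal entry_kernel (subalg S 1)"
  unfolding left_ideal_iff by (auto simp: entry_kernel_def closed entry_zero entry_add entry_mult)

lemma entry_kernel_ideal: "ideal entry_kernel (subalg S 1)"
  by (rule ideal_subalgI[OF entry_kernel_left_ideal]) (auto simp: entry_kernel_def closed entry_mult)

text \<open>This left ideal is the annihilator of the \<open>b\<close>-th unit vector in the simple \<open>S\<close>-module \<open>\<complex>^(n j)\<close> given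
by the block \<open>j\<close>. Maximality is the usual transitivity argument: an element \<open>y\<close> that does not kill
the vector can be multiplied from the left so as to map it to itself.\<close>

lemma column_annihilator_maximal:
  assumes j: "j \<in> J" and b: "b < n j"
  shows "maximal_left_ideal {y \<in> S. \<forall>a<n j. entry j a b y = 0} (subalg S 1)"
    (is "maximal_left_ideal ?M _")
  unfolding maximal_left_ideal_def
proof (intro conjI allI impI)
  show "left_ideal ?M (subalg S 1)"
    unfolding left_ideal_iff using j b
    by (auto simp: closed entry_zero entry_add entry_mult)
  have "1 \<notin> ?M" using j b by (auto simp: entry_one)
  then show "?M \<noteq> carrier (subalg S 1)" using unit_closed by auto
next
  fix L assume L: "left_ideal L (subalg S 1) \<and> ?M \<subseteq> L"
  show "L = ?M \<or> L = carrier (subalg S 1)"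
  proof (cases "L = ?M")
    case False
    then obtain y where y: "y \<in> L" "y \<notin> ?M" using L by blast
    have yS: "y \<in> S" using y(1) L by (auto simp: left_ideal_iff)
    then obtain a where a: "a < n j" and ne: "entry j a b y \<noteq> 0" using y(2) by auto
    \<comment> \<open>A multiple of the matrix unit at position \<open>(b, a)\<close>, so that \<open>w * y\<close> has the \<open>b\<close>-th unit vector
      as its \<open>b\<close>-th column in the block \<open>j\<close>.\<close>
    define w where "w = (1 / entry j a b y) *\<^sub>C (v j b * u j a)"
    have wS: "w \<in> S" using j a b by (simp add: w_def closed u_closed v_closed)
    have "entry j c b (w * y) = (if c = b then 1 else 0)" if c: "c < n j" for c
    proof -
      have "entry j c b (w * y) = (\<Sum>d<n j. entry j c d w * entry j d b y)"
        by (rule entry_mult[OF j c b wS yS])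
      also have "\<dots> = (\<Sum>d<n j. if d = a then (if c = b then 1 else 0) else 0)"
        using j a b c ne
        by (intro sum.cong refl) (auto simp: w_def entry_scaleC entry_unit closed u_closed v_closed)
      also have "\<dots> = (if c = b then 1 else 0)" using a by simp
      finally show ?thesis .
    qed
    then have "1 - w * y \<in> ?M"
      using j b wS yS by (auto simp: closed entry_diff entry_one)
    moreover have "w * y \<in> L" using L wS y(1) by (auto simp: left_ideal_iff)
    ultimately have "(1 - w * y) + w * y \<in> L" using L unfolding left_ideal_iff by blast
    then show ?thesis using left_ideal_eq_carrier L by simp
  qed simp
qed

text \<open>As \<open>x\<close> is the sum of the \<open>x * (v j a * u j a)\<close>, it suffices to place each of these in \<open>M\<close>. If
one of them is missing from \<open>M\<close>, then together with \<open>M\<close> it generates the whole of \<open>S\<close> as a left ideal, and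
compressing the resulting expression of \<open>v j a * u j a\<close> to the local corner \<open>C j\<close> shows that
\<open>v j a * u j a\<close> is in \<open>M\<close> after all.\<close>

lemma entry_kernel_subset_maximal:
  assumes M: "maximal_left_ideal M (subalg S 1)"
  shows "entry_kernel \<subseteq> M"
proof
  fix x assume x: "x \<in> entry_kernel"
  have M': "left_ideal M (subalg S 1)" using M by (simp add: maximal_left_ideal_def)
  have xS: "x \<in> S" using x by (simp add: entry_kernel_def)
  have col: "x * (v j a * u j a) \<in> M" if j: "j \<in> J" and a: "a < n j" for j a
  proof (cases "v j a * u j a \<in> M")
    case True
    then show ?thesis using M' xS by (auto simp: left_ideal_iff)
  next
    case False
    let ?p = "v j a * u j a"
    have pS: "?p \<in> S" using j a by (simp add: closed u_closed v_closed)
    show ?thesis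
    proof (rule ccontr)
      assume "x * ?p \<notin> M"
      moreover have xpS: "x * ?p \<in> S" using xS pS by (rule mult_closed)
      note L = left_ideal_principal[OF xpS]
      ultimately have nsub: "\<not> (\<lambda>b. b * (x * ?p)) ` S \<subseteq> M" using L(2) by blast
      obtain z m where z: "z \<in> (\<lambda>b. b * (x * ?p)) ` S" "m \<in> M" "?p = z + m"
        by (rule maximal_left_ideal_comaximal[OF M L(1) nsub pS])
      then obtain b where b: "b \<in> S" and m: "m \<in> M" "?p = b * (x * ?p) + m" by auto
      \<comment> \<open>The kernel element \<open>b * x\<close> compressed to the corner at \<open>q j\<close>.\<close>
      define r where "r = u j a * (b * x) * v j a"
      have bx: "b * x \<in> entry_kernel" using entry_kernel_left_ideal b x by (auto simp: left_ideal_iff)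
      have r: "r \<in> C j" "\<phi> j r = 0"
        using bx j a compression_in_C[OF j a a, of "b * x"]
        by (auto simp: r_def entry_kernel_def entry_def)
      have qu: "u j a * ?p = u j a"
        using j a by (simp add: u_v q_u flip: mult.assoc)
      have "u j a * ?p = u j a * (b * (x * ?p)) + u j a * m"
        using m(2) by (metis distrib_left)
      then have "u j a * m = u j a - r * u j a"
        unfolding qu r_def mult.assoc by (metis add_diff_cancel_left')
      then have um: "u j a * m = (q j - r) * u j a"
        using j a by (simp add: left_diff_distrib q_u)
      have "q j - r = q j + (- 1) *\<^sub>C r" by simp
      then have "q j - r \<in> C j" "\<phi> j (q j - r) = 1"
        using C_add[OF q_in_C[OF j] C_scaleC[OF r(1), of "- 1"]]
          char_add[OF j q_in_C[OF j] C_scaleC[OF r(1), of "- 1"]]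
          char_scaleC[OF j r(1), of "- 1"] r(2) char_unit[OF j] by auto
      then obtain c where c: "c \<in> C j" "c * (q j - r) = q j" using char_inverse[OF j] by force
      have "(v j a * c * u j a) * m = v j a * (c * (q j - r)) * u j a"
        using um by (simp add: mult.assoc)
      also have "\<dots> = ?p" using j a by (simp add: c(2) v_q)
      finally have "(v j a * c * u j a) * m = ?p" .
      moreover have "v j a * c * u j a \<in> S"
        using j a c(1) by (simp add: C_def closed u_closed v_closed)
      ultimately have "?p \<in> M" using M' m(1) unfolding left_ideal_iff by metis
      then show False using False by simp
    qed
  qed
  have "x = x * (\<Sum>j\<in>J. \<Sum>a<n j. v j a * u j a)" by (simp add: sum_v_u)
  also have "\<dots> = (\<Sum>j\<in>J. \<Sum>a<n j. x * (v j a * u j a))" by (simp add: sum_distrib_left)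
  also have "\<dots> \<in> M" by (intro left_ideal_sum[OF M'] col) auto
  finally show "x \<in> M" .
qed

lemma rad_eq_entry_kernel: "rad = entry_kernel"
proof
  show "rad \<subseteq> entry_kernel"
    using column_annihilator_maximal by (fastforce simp: rad_iff entry_kernel_def)
  show "entry_kernel \<subseteq> rad"
  proof
    fix x assume "x \<in> entry_kernel"
    then show "x \<in> rad" using entry_kernel_subset_maximal by (auto simp: rad_iff) (simp add: entry_kernel_def)
  qed
qed

definition matrix_family :: "'b \<Rightarrow> 'j \<Rightarrow> complex mat" where
  "matrix_family x = (\<lambda>j\<in>J. Matrix.mat (n j) (n j) (\<lambda>(a, b). entry j a b x))"

lemma matrix_family_surj: "matrix_family ` S = (\<Pi>\<^sub>E j\<in>J. carrier_mat (n j) (n j))"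
proof
  show "matrix_family ` S \<subseteq> (\<Pi>\<^sub>E j\<in>J. carrier_mat (n j) (n j))" by (auto simp: matrix_family_def)
  show "(\<Pi>\<^sub>E j\<in>J. carrier_mat (n j) (n j)) \<subseteq> matrix_family ` S"
  proof
    fix f :: "'j \<Rightarrow> complex mat" assume f: "f \<in> (\<Pi>\<^sub>E j\<in>J. carrier_mat (n j) (n j))"
    define x where "x = (\<Sum>j\<in>J. \<Sum>a<n j. \<Sum>b<n j. (f j $$ (a, b)) *\<^sub>C (v j a * u j b))"
    have t: "(f j $$ (a, b)) *\<^sub>C (v j a * u j b) \<in> S" if "j \<in> J" "a < n j" "b < n j" for j a b
      using that by (simp add: closed u_closed v_closed)
    have x: "x \<in> S" unfolding x_def by (intro sum_closed) (auto intro: t)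
    have e: "entry j c d x = f j $$ (c, d)" if j: "j \<in> J" and c: "c < n j" and d: "d < n j" for j c d
    proof -
      note sum = entry_sum[OF j c d]
      have "entry j c d x = (\<Sum>i\<in>J. entry j c d (\<Sum>a<n i. \<Sum>b<n i. (f i $$ (a, b)) *\<^sub>C (v i a * u i b)))"
        unfolding x_def by (rule sum) (intro sum_closed, auto intro: t)
      also have "\<dots> = (\<Sum>i\<in>J. \<Sum>a<n i. entry j c d (\<Sum>b<n i. (f i $$ (a, b)) *\<^sub>C (v i a * u i b)))"
        by (intro sum.cong refl sum sum_closed) (auto intro: t)
      also have "\<dots> = (\<Sum>i\<in>J. \<Sum>a<n i. \<Sum>b<n i. entry j c d ((f i $$ (a, b)) *\<^sub>C (v i a * u i b)))"
        by (intro sum.cong refl sum) (auto intro: t)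
      also have "\<dots> = (\<Sum>i\<in>J. \<Sum>a<n i. \<Sum>b<n i.
            if i = j \<and> a = c \<and> b = d then f j $$ (c, d) else 0)"
        using j c d by (intro sum.cong refl)
          (auto simp: entry_scaleC entry_unit closed u_closed v_closed)
      also have "\<dots> = (\<Sum>i\<in>J. if i = j then f j $$ (c, d) else 0)"
      proof (intro sum.cong refl)
        fix i assume "i \<in> J"
        have "(\<Sum>b<n i. if i = j \<and> a = c \<and> b = d then f j $$ (c, d) else 0)
            = (if a = c then (if i = j then f j $$ (c, d) else 0) else 0)" for a
          using d by (cases "i = j \<and> a = c") auto
        then show "(\<Sum>a<n i. \<Sum>b<n i. if i = j \<and> a = c \<and> b = d then f j $$ (c, d) else 0)
            = (if i = j then f j $$ (c, d) else 0)"
          using c by (cases "i = j") auto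
      qed
      also have "\<dots> = f j $$ (c, d)" using j finite_J by simp
      finally show ?thesis .
    qed
    have "matrix_family x = f"
    proof (rule PiE_ext)
      show "matrix_family x \<in> (\<Pi>\<^sub>E j\<in>J. carrier_mat (n j) (n j))" by (auto simp: matrix_family_def)
      show "f \<in> (\<Pi>\<^sub>E j\<in>J. carrier_mat (n j) (n j))" by fact
      fix j assume j: "j \<in> J"
      then have "f j \<in> carrier_mat (n j) (n j)" using f by auto
      then show "matrix_family x j = f j" using j e by (intro eq_matI) (auto simp: matrix_family_def)
    qed
    then show "f \<in> matrix_family ` S" using x by blast
  qed
qed

lemma quot_alg_iso_matrices:
  "quot_alg (subalg S 1) rad \<cong>\<^sub>a\<^sub>l\<^sub>g direct_sum_alg J (\<lambda>j. mat_alg (n j))"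
  unfolding rad_eq_entry_kernel
proof (rule quot_alg_isoI[OF entry_kernel_ideal, of matrix_family])
  show "matrix_family ` S = carrier (direct_sum_alg J (\<lambda>j. mat_alg (n j)))"
    by (simp add: matrix_family_surj direct_sum_alg_def module_mat_def)
  show "matrix_family 1 = \<one>\<^bsub>direct_sum_alg J (\<lambda>j. mat_alg (n j))\<^esub>"
    by (auto simp: matrix_family_def direct_sum_alg_def module_mat_def entry_one fun_eq_iff restrict_def
        intro!: eq_matI)
next
  fix x y assume xy: "x \<in> S" "y \<in> S"
  show "matrix_family (x + y) = matrix_family x \<oplus>\<^bsub>direct_sum_alg J (\<lambda>j. mat_alg (n j))\<^esub> matrix_family y"
    using xy by (auto simp: matrix_family_def direct_sum_alg_def module_mat_def entry_add fun_eq_iff restrict_def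
        intro!: eq_matI)
  show "matrix_family (x * y) = matrix_family x \<otimes>\<^bsub>direct_sum_alg J (\<lambda>j. mat_alg (n j))\<^esub> matrix_family y"
    using xy by (auto simp: matrix_family_def direct_sum_alg_def module_mat_def entry_mult fun_eq_iff restrict_def
        scalar_prod_def atLeast0LessThan intro!: eq_matI)
  show "matrix_family x = matrix_family y \<longleftrightarrow> x - y \<in> entry_kernel"
  proof
    assume eq: "matrix_family x = matrix_family y"
    have "entry j a b x = entry j a b y" if "j \<in> J" "a < n j" "b < n j" for j a b
      using arg_cong[OF fun_cong[OF eq, of j], of "\<lambda>m. m $$ (a, b)"] that by (simp add: matrix_family_def)
    then show "x - y \<in> entry_kernel" using xy by (auto simp: entry_kernel_def closed entry_diff)
  next
    assume "x - y \<in> entry_kernel"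
    then show "matrix_family x = matrix_family y"
      using xy by (auto simp: matrix_family_def entry_kernel_def entry_diff fun_eq_iff restrict_def intro!: eq_matI)
  qed
next
  fix c x assume x: "x \<in> S"
  show "matrix_family (c *\<^sub>C x) = c \<odot>\<^bsub>direct_sum_alg J (\<lambda>j. mat_alg (n j))\<^esub> matrix_family x"
    using x by (auto simp: matrix_family_def direct_sum_alg_def module_mat_def entry_scaleC fun_eq_iff
        restrict_def intro!: eq_matI)
qed

end

section \<open>Commutants and their corners\<close>

lemma comm_mod_rad_univ_alg:
  "comm_mod_rad T univ_alg
    = quot_alg (subalg {X. T * X = X * T} 1) (jacobson_radical (subalg {X. T * X = X * T} 1))"
proof -
  have "commutant T univ_alg = subalg {X. T * X = X * T} 1"
    by (simp add: commutant_def univ_alg_def)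
  then show ?thesis by (simp add: comm_mod_rad_def)
qed

lemma comm_mod_rad_corner_alg:
  fixes T P :: "'b::complex_banach_algebra_1"
  defines "C \<equiv> {X \<in> peirce P P. T * X = X * T}"
  shows "comm_mod_rad T (corner_alg P) = quot_alg (subalg C P) (jacobson_radical (subalg C P))"
proof -
  have "commutant T (corner_alg P) = subalg C P"
    by (simp add: commutant_def corner_alg_def univ_alg_def C_def)
  then show ?thesis by (simp add: comm_mod_rad_def)
qed

lemma peirce_iff:
  assumes "P * P = P" "Q * Q = Q"
  shows "X \<in> peirce P Q \<longleftrightarrow> P * X = X \<and> X * Q = X"
proof
  assume "X \<in> peirce P Q"
  then show "P * X = X \<and> X * Q = X"
    using assms by (auto simp: peirce_def mult.assoc) (simp flip: mult.assoc)
next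
  assume "P * X = X \<and> X * Q = X"
  then have "X = P * X * Q" by simp
  then show "X \<in> peirce P Q" unfolding peirce_def by blast
qed

lemma unital_subalgebra_commutant:
  "unital_subalgebra {X. T * X = X * (T :: 'b::complex_banach_algebra_1)} 1"
proof
  fix x y assume "x \<in> {X. T * X = X * T}" "y \<in> {X. T * X = X * T}"
  then have "T * x * y = x * (y * T)" by (simp add: mult.assoc)
  then show "x * y \<in> {X. T * X = X * T}" by (simp add: mult.assoc)
qed (auto simp: distrib_left distrib_right mult_scaleC_left mult_scaleC_right)

text \<open>The corner of the commutant is the commutant in the corner, because \<open>T\<close> acts on elements of the
corner at \<open>P\<close> as \<open>T\<^sub>P\<close> does.\<close>

lemma corner_commutant_eq:
  assumes "P * P = P" "T * P = T\<^sub>P" "P * T = (T\<^sub>P :: 'b::complex_banach_algebra_1)"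
  shows "{X \<in> peirce P P. T\<^sub>P * X = X * T\<^sub>P} = {X \<in> {X. T * X = X * T}. P * X = X \<and> X * P = X}"
proof -
  have "T\<^sub>P * X = T * X" "X * T\<^sub>P = X * T" if "P * X = X" "X * P = X" for X
    using that assms(2,3) by (metis mult.assoc)+
  then show ?thesis by (auto simp: peirce_iff[OF assms(1,1)])
qed

text \<open>Similarity of the two corner elements is equivalence of the idempotents \<open>P\<close> and \<open>Q\<close> inside the
commutant of \<open>T\<close>: the intertwining equation \<open>T\<^sub>Q = y T\<^sub>P x\<close> amounts to \<open>x\<close> and \<open>y\<close> commuting
with \<open>T\<close>.\<close>

lemma corner_similar_in_commutant:
  fixes T :: "'b::complex_banach_algebra_1"
  assumes P: "P * P = P" "T * P = T\<^sub>P" "P * T = T\<^sub>P"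
    and Q: "Q * Q = Q" "T * Q = T\<^sub>Q" "Q * T = T\<^sub>Q"
  shows "corner_similar T\<^sub>P P T\<^sub>Q Q \<longleftrightarrow>
    (\<exists>x y. T * x = x * T \<and> T * y = y * T \<and> P * x = x \<and> x * Q = x \<and> Q * y = y \<and> y * P = y \<and>
      x * y = P \<and> y * x = Q)"
proof
  assume "corner_similar T\<^sub>P P T\<^sub>Q Q"
  then obtain x y where "x \<in> peirce P Q" "y \<in> peirce Q P"
    and xy: "x * y = P" "y * x = Q" and TQ: "T\<^sub>Q = y * T\<^sub>P * x"
    unfolding corner_similar_def by blast
  then have x: "P * x = x" "x * Q = x" and y: "Q * y = y" "y * P = y"
    using peirce_iff[OF P(1) Q(1)] peirce_iff[OF Q(1) P(1)] by simp_all
  have "P * (P * T) = P * P * T" "T * P * P = T * (P * P)" by (simp_all add: mult.assoc)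
  then have PTP: "P * T\<^sub>P = T\<^sub>P" "T\<^sub>P * P = T\<^sub>P" using P by simp_all
  have "T * x = T * P * x" "x * T = x * (Q * T)"
    using x by (simp add: mult.assoc, simp flip: mult.assoc)
  moreover have "x * (y * T\<^sub>P * x) = x * y * T\<^sub>P * x" by (simp add: mult.assoc)
  ultimately have Tx: "T * x = x * T" using P Q PTP xy TQ by simp
  have "T * y = T * Q * y" "y * T = y * (P * T)"
    using y by (simp add: mult.assoc, simp flip: mult.assoc)
  moreover have "y * T\<^sub>P * x * y = y * (T\<^sub>P * (x * y))" by (simp add: mult.assoc)
  ultimately have Ty: "T * y = y * T" using P Q PTP xy TQ by simp
  show "\<exists>x y. T * x = x * T \<and> T * y = y * T \<and> P * x = x \<and> x * Q = x \<and> Q * y = y \<and> y * P = y \<and>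
      x * y = P \<and> y * x = Q"
    using x y xy Tx Ty by blast
next
  assume "\<exists>x y. T * x = x * T \<and> T * y = y * T \<and> P * x = x \<and> x * Q = x \<and> Q * y = y \<and> y * P = y \<and>
      x * y = P \<and> y * x = Q"
  then obtain x y where T: "T * x = x * T" "T * y = y * T" and x: "P * x = x" "x * Q = x"
    and y: "Q * y = y" "y * P = y" and xy: "x * y = P" "y * x = Q" by blast
  have "y * (T * P) * x = y * (T * (P * x))" by (simp add: mult.assoc)
  also have "\<dots> = (y * x) * T" by (simp add: x T mult.assoc)
  finally have "T\<^sub>Q = y * T\<^sub>P * x" using xy(2) P(2) Q(3) by simp
  moreover have "x \<in> peirce P Q" "y \<in> peirce Q P"
    using x y peirce_iff[OF P(1) Q(1)] peirce_iff[OF Q(1) P(1)] by simp_all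
  ultimately show "corner_similar T\<^sub>P P T\<^sub>Q Q"
    unfolding corner_similar_def using xy by blast
qed

section \<open>The quotient of the commutant\<close>

theorem proposition5p11:
  fixes k :: nat and n :: "nat \<Rightarrow> nat"
    and P T :: "nat \<Rightarrow> nat \<Rightarrow> 'b::complex_banach_algebra_1"
  assumes "1 \<le> k"
    and "\<And>j. j \<in> {1..k} \<Longrightarrow> 1 \<le> n j"
    and "finite_decomposition {(i, j). j \<in> {1..k} \<and> i \<in> {1..n j}} (\<lambda>(i, j). P i j)"
    and "\<And>i j. j \<in> {1..k} \<Longrightarrow> i \<in> {1..n j} \<Longrightarrow> T i j \<in> carrier (corner_alg (P i j))"
    and "\<And>i j. j \<in> {1..k} \<Longrightarrow> i \<in> {1..n j} \<Longrightarrow>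
           comm_mod_rad (T i j) (corner_alg (P i j)) \<cong>\<^sub>a\<^sub>l\<^sub>g (univ_alg :: (complex, complex) module)"
    and "\<And>i\<^sub>1 j\<^sub>1 i\<^sub>2 j\<^sub>2. j\<^sub>1 \<in> {1..k} \<Longrightarrow> j\<^sub>2 \<in> {1..k} \<Longrightarrow> i\<^sub>1 \<in> {1..n j\<^sub>1} \<Longrightarrow> i\<^sub>2 \<in> {1..n j\<^sub>2} \<Longrightarrow>
           corner_similar (T i\<^sub>1 j\<^sub>1) (P i\<^sub>1 j\<^sub>1) (T i\<^sub>2 j\<^sub>2) (P i\<^sub>2 j\<^sub>2) \<longleftrightarrow> j\<^sub>1 = j\<^sub>2"
  shows "comm_mod_rad (\<Sum>j=1..k. \<Sum>i=1..n j. T i j) (univ_alg :: (complex, 'b) module)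
           \<cong>\<^sub>a\<^sub>l\<^sub>g direct_sum_alg {1..k} (\<lambda>j. mat_alg (n j))"
proof -
  define Tsum where "Tsum = (\<Sum>j=1..k. \<Sum>i=1..n j. T i j)"
  define S where "S = {X. Tsum * X = X * Tsum}"
  define ix where "ix i j \<longleftrightarrow> j \<in> {1..k} \<and> i \<in> {1..n j}" for i j
  interpret unital_subalgebra S 1
    unfolding S_def by (rule unital_subalgebra_commutant)
  have P_idem: "P i j * P i j = P i j" and P_ne: "P i j \<noteq> 0" if "ix i j" for i j
    using assms(3) that unfolding finite_decomposition_def nonzero_idempotent_def ix_def by auto
  have P_orth: "P i j * P i' j' = 0" if "ix i j" "ix i' j'" "(i, j) \<noteq> (i', j')" for i j i' j'
    using assms(3) that unfolding finite_decomposition_def ix_def by auto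
  have sum_P: "(\<Sum>j=1..k. \<Sum>i=1..n j. P i j) = 1"
  proof -
    have "(\<Sum>j=1..k. \<Sum>i=1..n j. P i j) = (\<Sum>(j, i)\<in>(SIGMA j:{1..k}. {1..n j}). P i j)"
      by (rule sum.Sigma) auto
    also have "\<dots> = (\<Sum>(i, j)\<in>{(i, j). j \<in> {1..k} \<and> i \<in> {1..n j}}. P i j)"
      by (rule sum.reindex_bij_witness[of _ prod.swap prod.swap]) auto
    also have "\<dots> = 1" using assms(3) by (simp add: finite_decomposition_def)
    finally show ?thesis .
  qed
  have T_corner: "P i j * T i j = T i j" "T i j * P i j = T i j" if "ix i j" for i j
    using assms(4)[of j i] that P_idem[OF that] peirce_iff[of "P i j" "P i j" "T i j"]
    by (auto simp: corner_alg_def ix_def)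
  have T_P: "T i' j' * P i j = (if i' = i \<and> j' = j then T i j else 0)"
    "P i j * T i' j' = (if i' = i \<and> j' = j then T i j else 0)"
    if "ix i j" "ix i' j'" for i j i' j'
  proof -
    have "T i' j' * P i j = T i' j' * (P i' j' * P i j)"
      using T_corner(2)[OF that(2)] by (simp flip: mult.assoc)
    then show "T i' j' * P i j = (if i' = i \<and> j' = j then T i j else 0)"
      using T_corner(2)[OF that(1)] P_orth[OF that(2,1)] by auto
    have "P i j * T i' j' = (P i j * P i' j') * T i' j'"
      using T_corner(1)[OF that(2)] by (simp add: mult.assoc)
    then show "P i j * T i' j' = (if i' = i \<and> j' = j then T i j else 0)"
      using T_corner(1)[OF that(1)] P_orth[OF that] by auto
  qed
  \<comment> \<open>The given sums contain exactly one term that survives multiplication by \<open>P i j\<close>.\<close>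
  have pick: "(\<Sum>j'=1..k. \<Sum>i'=1..n j'. if i' = i \<and> j' = j then T i j else 0) = T i j"
    if "ix i j" for i j
  proof -
    have "(\<Sum>i'=1..n j'. if i' = i \<and> j' = j then T i j else 0) = (if j' = j then T i j else 0)" for j'
      using that by (cases "j' = j") (auto simp: ix_def)
    then show ?thesis using that by (simp add: ix_def)
  qed
  have Tsum_P: "Tsum * P i j = T i j" and P_Tsum: "P i j * Tsum = T i j" if ij: "ix i j" for i j
  proof -
    have "Tsum * P i j = (\<Sum>j'=1..k. \<Sum>i'=1..n j'. T i' j' * P i j)"
      by (simp add: Tsum_def sum_distrib_right)
    also have "\<dots> = (\<Sum>j'=1..k. \<Sum>i'=1..n j'. if i' = i \<and> j' = j then T i j else 0)"
      by (intro sum.cong refl T_P(1) ij) (simp add: ix_def)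
    finally show "Tsum * P i j = T i j" using pick[OF ij] by simp
    have "P i j * Tsum = (\<Sum>j'=1..k. \<Sum>i'=1..n j'. P i j * T i' j')"
      by (simp add: Tsum_def sum_distrib_left)
    also have "\<dots> = (\<Sum>j'=1..k. \<Sum>i'=1..n j'. if i' = i \<and> j' = j then T i j else 0)"
      by (intro sum.cong refl T_P(2) ij) (simp add: ix_def)
    finally show "P i j * Tsum = T i j" using pick[OF ij] by simp
  qed
  have P_S: "P i j \<in> S" if "ix i j" for i j
    using Tsum_P[OF that] P_Tsum[OF that] by (simp add: S_def)
  have similar_iff: "(\<exists>x y. x \<in> S \<and> y \<in> S \<and> P i j * x = x \<and> x * P i' j' = x \<and>
      P i' j' * y = y \<and> y * P i j = y \<and> x * y = P i j \<and> y * x = P i' j') \<longleftrightarrow> j = j'"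
    if "ix i j" "ix i' j'" for i j i' j'
    using corner_similar_in_commutant[OF P_idem[OF that(1)] Tsum_P[OF that(1)] P_Tsum[OF that(1)]
        P_idem[OF that(2)] Tsum_P[OF that(2)] P_Tsum[OF that(2)]] assms(6)[of j j' i i'] that
    by (simp add: S_def ix_def)
  define q where "q j = P 1 j" for j
  have ix1: "ix 1 j" if "j \<in> {1..k}" for j
    using assms(2)[OF that] that by (simp add: ix_def)
  have ixS: "ix (Suc a) j" if "j \<in> {1..k}" "a < n j" for a j
    using that by (simp add: ix_def)
  define C where "C j = {x \<in> S. q j * x = x \<and> x * q j = x}" for j
  \<comment> \<open>Matrix indices start at \<open>0\<close> and the given index sets at \<open>1\<close>, hence the shift by \<open>Suc\<close>. The
    base idempotent is included, with any equivalence from \<open>q j\<close> to itself.\<close>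
  have "\<exists>uv. fst uv \<in> S \<and> snd uv \<in> S \<and> q j * fst uv = fst uv \<and> fst uv * P (Suc a) j = fst uv \<and>
      P (Suc a) j * snd uv = snd uv \<and> snd uv * q j = snd uv \<and>
      fst uv * snd uv = q j \<and> snd uv * fst uv = P (Suc a) j"
    if "j \<in> {1..k}" "a < n j" for j a
    using similar_iff[OF ix1[OF that(1)] ixS[OF that]] by (force simp: q_def)
  then obtain w where w: "\<And>j a. j \<in> {1..k} \<Longrightarrow> a < n j \<Longrightarrow>
      fst (w j a) \<in> S \<and> snd (w j a) \<in> S \<and> q j * fst (w j a) = fst (w j a) \<and>
      fst (w j a) * P (Suc a) j = fst (w j a) \<and>
      P (Suc a) j * snd (w j a) = snd (w j a) \<and> snd (w j a) * q j = snd (w j a) \<and>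
      fst (w j a) * snd (w j a) = q j \<and> snd (w j a) * fst (w j a) = P (Suc a) j"
    by metis
  define u v where "u j a = fst (w j a)" and "v j a = snd (w j a)" for j a
  note uv = w[folded u_def v_def]
  have "\<exists>f :: 'b \<Rightarrow> complex. (\<forall>x\<in>C j. \<forall>y\<in>C j. f (x + y) = f x + f y \<and> f (x * y) = f x * f y) \<and>
      (\<forall>x\<in>C j. \<forall>c. f (c *\<^sub>C x) = c * f x) \<and> f (q j) = 1 \<and>
      (\<forall>x\<in>C j. f x \<noteq> 0 \<longrightarrow> (\<exists>c\<in>C j. c * x = q j))" if j: "j \<in> {1..k}" for j
  proof -
    note i = ix1[OF j]
    interpret Cj: unital_subalgebra "C j" "q j"
      unfolding C_def using P_S[OF i] P_idem[OF i] by (intro unital_subalgebra_corner) (simp_all add: q_def)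
    have "{X \<in> peirce (q j) (q j). T 1 j * X = X * T 1 j} = C j"
      unfolding C_def S_def q_def
      by (rule corner_commutant_eq[OF P_idem[OF i] Tsum_P[OF i] P_Tsum[OF i]])
    then have "quot_alg (subalg (C j) (q j)) Cj.rad \<cong>\<^sub>a\<^sub>l\<^sub>g (univ_alg :: (complex, complex) module)"
      using assms(5)[of j 1] i comm_mod_rad_corner_alg[of "T 1 j" "q j"] by (simp add: q_def ix_def)
    from Cj.character_of_local[OF this] obtain f :: "'b \<Rightarrow> complex" where
      "\<And>x y. x \<in> C j \<Longrightarrow> y \<in> C j \<Longrightarrow> f (x + y) = f x + f y"
      "\<And>x y. x \<in> C j \<Longrightarrow> y \<in> C j \<Longrightarrow> f (x * y) = f x * f y"
      "\<And>c x. x \<in> C j \<Longrightarrow> f (c *\<^sub>C x) = c * f x" "f (q j) = 1"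
      "\<And>x. x \<in> C j \<Longrightarrow> f x \<noteq> 0 \<Longrightarrow> \<exists>c\<in>C j. c * x = q j" by blast
    then show ?thesis by (intro exI[of _ f]) blast
  qed
  then obtain \<phi> :: "nat \<Rightarrow> 'b \<Rightarrow> complex" where \<phi>: "\<And>j. j \<in> {1..k} \<Longrightarrow>
      (\<forall>x\<in>C j. \<forall>y\<in>C j. \<phi> j (x + y) = \<phi> j x + \<phi> j y \<and> \<phi> j (x * y) = \<phi> j x * \<phi> j y) \<and>
      (\<forall>x\<in>C j. \<forall>c. \<phi> j (c *\<^sub>C x) = c * \<phi> j x) \<and> \<phi> j (q j) = 1 \<and>
      (\<forall>x\<in>C j. \<phi> j x \<noteq> 0 \<longrightarrow> (\<exists>c\<in>C j. c * x = q j))"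
    by metis
  have "local_matrix_frame S {1..k} n q u v \<phi>"
  proof (unfold_locales, fold C_def)
    show "finite {1..k}" by simp
    fix j assume j: "j \<in> {1..k}"
    show "q j \<in> S" "q j * q j = q j" using P_S[OF ix1[OF j]] P_idem[OF ix1[OF j]] by (simp_all add: q_def)
    show "u j a \<in> S" "v j a \<in> S" "q j * u j a = u j a" "v j a * q j = v j a" if "a < n j" for a
      using uv[OF j that] by auto
    show "u j a * v i b = (if j = i \<and> a = b then q j else 0)" if "a < n j" "i \<in> {1..k}" "b < n i" for a i b
    proof (cases "j = i \<and> a = b")
      case True
      then show ?thesis using uv[OF j that(1)] by auto
    next
      case False
      have "u j a * v i b = u j a * (P (Suc a) j * P (Suc b) i) * v i b"
        using uv[OF j that(1)] uv[OF that(2,3)] by (metis mult.assoc)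
      then show ?thesis
        using False P_orth[OF ixS[OF j that(1)] ixS[OF that(2,3)]] by auto
    qed
    show "\<phi> j (x + y) = \<phi> j x + \<phi> j y" "\<phi> j (x * y) = \<phi> j x * \<phi> j y" if "x \<in> C j" "y \<in> C j" for x y
      using \<phi>[OF j] that by blast+
    show "\<phi> j (c *\<^sub>C x) = c * \<phi> j x" if "x \<in> C j" for c x using \<phi>[OF j] that by blast
    show "\<phi> j (q j) = 1" using \<phi>[OF j] by blast
    show "\<exists>c\<in>C j. c * x = q j" if "x \<in> C j" "\<phi> j x \<noteq> 0" for x using \<phi>[OF j] that by blast
    fix i x y assume i: "i \<in> {1..k}" and ne: "j \<noteq> i" and x: "x \<in> S" and y: "y \<in> S"
    note ji = ix1[OF j] ix1[OF i]
    \<comment> \<open>A nonzero value would make \<open>q j\<close> and \<open>q i\<close> equivalent, contrary to the hypothesis on \<open>\<sim>\<close>.\<close>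
    show "\<phi> j ((q j * x * q i) * (q i * y * q j)) = 0"
    proof (rule ccontr)
      assume nz: "\<phi> j ((q j * x * q i) * (q i * y * q j)) \<noteq> 0"
      have qq: "q j \<in> S" "q j * q j = q j" "q j \<noteq> 0" "q i \<in> S" "q i * q i = q i"
        using P_S[OF ji(1)] P_S[OF ji(2)] P_idem[OF ji(1)] P_idem[OF ji(2)] P_ne[OF ji(1)]
        by (simp_all add: q_def)
      have qq': "q j * (q j * z) = q j * z" "q i * (q i * z) = q i * z" for z
        using qq by (simp_all flip: mult.assoc)
      obtain x' where "x' \<in> S" "q j * x' = x'" "x' * q i = x'"
        "x' * (q i * y * q j) = q j" "(q i * y * q j) * x' = q i"
      proof (rule equivalent_of_character_nonzero[of "q j" "q i" "\<phi> j" "\<phi> i" "q j * x * q i" "q i * y * q j"])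
        show "\<exists>c\<in>{x \<in> S. q j * x = x \<and> x * q j = x}. c * z = q j"
          if "z \<in> {x \<in> S. q j * x = x \<and> x * q j = x}" "\<phi> j z \<noteq> 0" for z
          using \<phi>[OF j] that unfolding C_def by blast
        show "\<exists>c\<in>{x \<in> S. q i * x = x \<and> x * q i = x}. c * z = q i"
          if "z \<in> {x \<in> S. q i * x = x \<and> x * q i = x}" "\<phi> i z \<noteq> 0" for z
          using \<phi>[OF i] that unfolding C_def by blast
        show "\<phi> i (z + z') = \<phi> i z + \<phi> i z'"
          if "z \<in> {x \<in> S. q i * x = x \<and> x * q i = x}" "z' \<in> {x \<in> S. q i * x = x \<and> x * q i = x}" for z z'
          using \<phi>[OF i] that unfolding C_def by blast
        show "\<phi> i (q i) = 1" using \<phi>[OF i] by blast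
      qed (use nz qq x y in \<open>simp_all add: closed mult.assoc qq'\<close>)
      moreover have "q i * y * q j \<in> S" "q i * (q i * y * q j) = q i * y * q j"
        "(q i * y * q j) * q j = q i * y * q j"
        using qq y by (simp_all add: closed mult.assoc qq')
      ultimately have "\<exists>x y. x \<in> S \<and> y \<in> S \<and> q j * x = x \<and> x * q i = x \<and>
          q i * y = y \<and> y * q j = y \<and> x * y = q j \<and> y * x = q i"
        by blast
      then show False using similar_iff[OF ji] ne by (simp add: q_def)
    qed
  next
    have "(\<Sum>j=1..k. \<Sum>a<n j. v j a * u j a) = (\<Sum>j=1..k. \<Sum>a<n j. P (Suc a) j)"
      using uv by (intro sum.cong refl) auto
    also have "\<dots> = 1" using sum_P by (simp add: sum.atLeast1_atMost_eq)
    finally show "(\<Sum>j=1..k. \<Sum>a<n j. v j a * u j a) = 1" .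
  qed
  then have "quot_alg (subalg S 1) rad \<cong>\<^sub>a\<^sub>l\<^sub>g direct_sum_alg {1..k} (\<lambda>j. mat_alg (n j))"
    by (rule local_matrix_frame.quot_alg_iso_matrices)
  then show ?thesis
    unfolding comm_mod_rad_univ_alg by (simp add: S_def Tsum_def)
qed

end
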